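(* Let $S$ be a semigroup such that the intersection ideal graph $\Gamma(S)$ contains a cycle. Then the girth of $\Gamma(S)$ is $g(\Gamma(S))=3$.
   Context: A left ideal of a semigroup $S$ is a non-empty subset $I\subseteq S$ with $SI\subseteq I$; it is nontrivial if $I\neq S$. The intersection of two left ideals is nontrivial if it is non-empty. The intersection ideal graph $\Gamma(S)$ is the simple undirected graph whose vertices are the nontrivial left ideals of $S$, with two distinct vertices $I,J$ adjacent if and only if $I\cap J$ is nontrivial. The girth is the length of a shortest cycle. *)

theory Defs
  imports "Graph_Theory.Graph_Theory" "HOL-Library.Extended_Nat"
begin

text \<open>The semigroup $S$ is the whole type \<open>'a :: semigroup_mult\<close>.\<close>

definition left_ideal :: "'a :: semigroup_mult set \<Rightarrow> bool" where
  "left_ideal I \<longleftrightarrow> I \<noteq> {} \<and> (\<forall>s. \<forall>x\<in>I. s * x \<in> I)"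

definition nontrivial_left_ideal :: "'a :: semigroup_mult set \<Rightarrow> bool" where
  "nontrivial_left_ideal I \<longleftrightarrow> left_ideal I \<and> I \<noteq> UNIV"

text \<open>
  As usual in \<open>Graph_Theory\<close>, an undirected graph is a symmetric digraph: each
  undirected edge $\{I, J\}$ is represented by the two arcs $(I, J)$ and $(J, I)$.
  The locale \<open>graph\<close> is not available, since it requires finiteness.
\<close>

definition intersection_ideal_graph :: "'a :: semigroup_mult set pair_pre_digraph" where
  "intersection_ideal_graph =
     \<lparr> pverts = {I. nontrivial_left_ideal I},
       parcs = {(I, J). nontrivial_left_ideal I \<and> nontrivial_left_ideal J \<and>
                        I \<noteq> J \<and> I \<inter> J \<noteq> {}} \<rparr>"

lemma intersection_ideal_graph_simple:
  "loopfree_digraph (with_proj intersection_ideal_graph)"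
  "nomulti_digraph (with_proj intersection_ideal_graph)"
  "sym_digraph (with_proj intersection_ideal_graph)"
  by (unfold_locales;
      auto simp: intersection_ideal_graph_def arc_to_ends_def symmetric_conv)+

text \<open>
  In a symmetric digraph the closed walk $u, v, u$ along one undirected edge is a
  \<open>cycle\<close> in the sense of \<open>Graph_Theory\<close>; in a simple graph, the bound on the length
  excludes exactly these.  Both definitions below are meant for simple graphs, i.e.
  symmetric digraphs without loops and parallel arcs.
\<close>

definition undirected_cycle :: "('v, 'e) pre_digraph \<Rightarrow> 'e awalk \<Rightarrow> bool" where
  "undirected_cycle G p \<longleftrightarrow> pre_digraph.cycle G p \<and> 3 \<le> length p"

text \<open>The girth of a graph without cycles is \<open>\<infinity>\<close>.\<close>

definition girth :: "('v, 'e) pre_digraph \<Rightarrow> enat" where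
  "girth G = (INF p\<in>{p. undirected_cycle G p}. enat (length p))"

end

theory Submission
  imports Defs
begin

text \<open>
  If \<open>A - B - C\<close> is a path and there is no triangle, then \<open>A \<inter> C = {}\<close>, and since \<open>A, B, A \<inter> B\<close>
  is not a triangle, \<open>A\<close> and \<open>B\<close> are comparable; \<open>B \<subseteq> A\<close> would give \<open>B \<inter> C \<subseteq> A \<inter> C\<close>, so
  \<open>A \<subset> B\<close>. Hence the middle vertex of every path properly contains both end vertices. Applied to the
  two paths formed by three consecutive edges of a cycle, this makes each of two
  adjacent vertices a proper subset of the other.
\<close>

abbreviation ideal_adj :: "'a :: semigroup_mult set \<Rightarrow> 'a set \<Rightarrow> bool" where
  "ideal_adj I J \<equiv> (I, J) \<in> parcs intersection_ideal_graph"

lemma ideal_adj_iff: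
  "ideal_adj I J \<longleftrightarrow> nontrivial_left_ideal I \<and> nontrivial_left_ideal J \<and> I \<noteq> J \<and> I \<inter> J \<noteq> {}"
  by (simp add: intersection_ideal_graph_def)

lemma ideal_adj_sym: "ideal_adj I J \<Longrightarrow> ideal_adj J I"
  by (auto simp: ideal_adj_iff)

lemma nontrivial_left_ideal_Int:
  assumes "nontrivial_left_ideal I" "nontrivial_left_ideal J" "I \<inter> J \<noteq> {}"
  shows "nontrivial_left_ideal (I \<inter> J)"
  using assms unfolding nontrivial_left_ideal_def left_ideal_def by blast

lemma comparable_or_triangle:
  fixes I J :: "'a :: semigroup_mult set"
  assumes "ideal_adj I J" "\<nexists>A B C :: 'a set. ideal_adj A B \<and> ideal_adj B C \<and> ideal_adj C A"
  shows "I \<subset> J \<or> J \<subset> I"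
proof (rule ccontr)
  assume "\<not> (I \<subset> J \<or> J \<subset> I)"
  \<comment> \<open>Incomparability makes \<open>I \<inter> J\<close> differ from both
    \<open>I\<close> and \<open>J\<close>; being non-empty, it meets each of them and completes a
    triangle.\<close>
  with assms(1) have "ideal_adj J (I \<inter> J)" "ideal_adj (I \<inter> J) I"
    using nontrivial_left_ideal_Int[of I J] by (auto simp: ideal_adj_iff)
  with assms show False by blast
qed

lemma path_end_psubset_middle:
  fixes A B C :: "'a :: semigroup_mult set"
  assumes "ideal_adj A B" "ideal_adj B C" "A \<noteq> C"
    and no_triangle: "\<nexists>A B C :: 'a set. ideal_adj A B \<and> ideal_adj B C \<and> ideal_adj C A"
  shows "A \<subset> B"
proof -
  have "\<not> ideal_adj C A"
    using assms by blast
  then have "A \<inter> C = {}"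
    using assms(1-3) by (auto simp: ideal_adj_iff)
  then have "\<not> B \<subset> A"
    using assms(2) by (auto simp: ideal_adj_iff)
  then show ?thesis
    using comparable_or_triangle[OF assms(1) no_triangle] by blast
qed

text \<open>Meant for the part of a cycle left after its first three arcs. That rest is empty for a
  triangle, and its two ends then coincide.\<close>

lemma cas_ends_in_awalk_verts:
  assumes "pre_digraph.cas G u p v"
  shows "u \<in> set (pre_digraph.awalk_verts G u p)" "v \<in> set (pre_digraph.awalk_verts G u p)"
  using assms
  by (induction p arbitrary: u)
    (auto simp: pre_digraph.cas.simps pre_digraph.awalk_verts.simps)

text \<open>The bound on the length supplies three consecutive arcs. In a triangle
  \<open>a = d\<close>, so nothing is claimed about this pair and all lengths are treated
  alike.\<close>

lemma undirected_cycle_imp_two_paths: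
  assumes "undirected_cycle (with_proj G) p"
  obtains a b c d where "(a, b) \<in> parcs G" "(b, c) \<in> parcs G" "(c, d) \<in> parcs G" "a \<noteq> c" "b \<noteq> d"
proof -
  from assms obtain u where
    walk: "pre_digraph.awalk (with_proj G) u p u"
    and dist: "distinct (tl (pre_digraph.awalk_verts (with_proj G) u p))"
    and len: "3 \<le> length p"
    by (auto simp: undirected_cycle_def pre_digraph.cycle_def)
  obtain e f g q where p: "p = e # f # g # q"
    using len by (auto simp: numeral_3_eq_3 Suc_le_length_iff)
  obtain a b b' c c' d where efg: "e = (a, b)" "f = (b', c)" "g = (c', d)"
    by (metis surj_pair)
  have arcs: "(a, b) \<in> parcs G" "(b', c) \<in> parcs G" "(c', d) \<in> parcs G"
    and cas: "b' = b" "c' = c" "a = u" "pre_digraph.cas (with_proj G) d q u"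
    using walk by (auto simp: p efg pre_digraph.awalk_def pre_digraph.cas.simps)
  have verts: "pre_digraph.awalk_verts (with_proj G) u p
      = a # b # c # pre_digraph.awalk_verts (with_proj G) d q"
    using cas by (cases q) (auto simp: p efg pre_digraph.awalk_verts.simps pre_digraph.cas.simps)
  have ends: "d \<in> set (pre_digraph.awalk_verts (with_proj G) d q)"
    "u \<in> set (pre_digraph.awalk_verts (with_proj G) d q)"
    using cas_ends_in_awalk_verts[OF cas(4)] by blast+
  \<comment> \<open>\<open>dist\<close> drops the initial \<open>a\<close> and concerns
    \<open>b\<close>, \<open>c\<close> and the vertices of the rest. The rest starts at
    \<open>d\<close>, whence \<open>b \<noteq> d\<close>, and ends at \<open>u = a\<close>, whence
    \<open>a \<noteq> c\<close>.\<close>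
  then have "b \<noteq> d" "a \<noteq> c"
    using dist cas by (auto simp: verts)
  then show thesis
    using that arcs cas by blast
qed

text \<open>Adjacency includes inequality, so the three vertices are distinct, as a cycle
  requires.\<close>

lemma ideal_triangle_undirected_cycle:
  assumes "ideal_adj A B" "ideal_adj B C" "ideal_adj C A"
  shows "undirected_cycle (with_proj intersection_ideal_graph) [(A, B), (B, C), (C, A)]"
  using assms
  by (auto simp: undirected_cycle_def pre_digraph.cycle_def pre_digraph.awalk_def
      pre_digraph.cas.simps pre_digraph.awalk_verts.simps intersection_ideal_graph_def)

theorem theorem4p1:
  fixes \<Gamma> :: "'a :: semigroup_mult set pair_pre_digraph"
  defines "\<Gamma> \<equiv> intersection_ideal_graph"
  assumes "\<exists>p. undirected_cycle (with_proj \<Gamma>) p"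
  shows "girth (with_proj \<Gamma>) = 3"
proof (rule antisym)
  obtain I J K L :: "'a set" where path: "ideal_adj I J" "ideal_adj J K" "ideal_adj K L" "I \<noteq> K" "J \<noteq> L"
    using assms undirected_cycle_imp_two_paths by metis
  have "\<exists>A B C :: 'a set. ideal_adj A B \<and> ideal_adj B C \<and> ideal_adj C A"
  proof (rule ccontr)
    assume no_triangle: "\<not> ?thesis"
    \<comment> \<open>The first path is read backwards, as \<open>K\<close>, \<open>J\<close>,
      \<open>I\<close>, to make \<open>K\<close> the end that is compared with the middle.\<close>
    have "K \<subset> J"
      using path_end_psubset_middle[OF ideal_adj_sym ideal_adj_sym _ no_triangle] path by blast
    moreover have "J \<subset> K"
      using path_end_psubset_middle[OF _ _ _ no_triangle] path by blast
    ultimately show False by blast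
  qed
  then obtain A B C :: "'a set" where "ideal_adj A B" "ideal_adj B C" "ideal_adj C A"
    by blast
  then have "undirected_cycle (with_proj \<Gamma>) [(A, B), (B, C), (C, A)]"
    unfolding \<Gamma>_def by (rule ideal_triangle_undirected_cycle)
  then have "girth (with_proj \<Gamma>) \<le> enat (length [(A, B), (B, C), (C, A)])"
    unfolding girth_def by (intro INF_lower) simp
  then show "girth (with_proj \<Gamma>) \<le> 3"
    by (simp add: numeral_eq_enat numeral_3_eq_3)
  \<comment> \<open>The lower bound is built into \<open>undirected_cycle\<close>.\<close>
  show "3 \<le> girth (with_proj \<Gamma>)"
    unfolding girth_def
    by (intro INF_greatest) (simp add: undirected_cycle_def numeral_eq_enat)
qed

end
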